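(* Let $N\in\mathbb{N}$, let $T_N:X_N\to X_N$, $T_Ny:=P_N\mathcal Z_N(y)$, be the projected bias operator, and for $y^\star\in X_N$ let $y_\infty(y^\star):=y^\star+\mathcal Z_N(y^\star)\in V'$ (all defined in the context). Let $y_r\in X_N$. (1) If $I+T_N:X_N\to X_N$ is invertible, then the equation $y^\star+T_Ny^\star=y_r$ in $X_N$ admits a unique solution $y^\star\in X_N$, and for this $y^\star$ one has $P_Ny_\infty(y^\star)=y_r$. (2) If, in addition, $\|T_N\|_{\mathcal L(X_N)}<1$ in some norm on $X_N$, then the Picard iteration $$y^{(0)}:=y_r,\qquad y^{(\ell+1)}:=y_r-T_Ny^{(\ell)},\quad \ell\ge0,$$ converges geometrically in $X_N$ to the unique solution $y^\star$ of $y^\star+T_Ny^\star=y_r$.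
   Context: $\Omega\subset\mathbb{R}^3$ is a bounded connected $C^2$ domain, $\kappa_m>0$, $H=L^2(\Omega)$; $A_0=\kappa_m\Delta$ with $D(A_0)=\{y\in H^2(\Omega):\partial_\nu y=0\}$; $\mathcal A=I-A_0$, $D(\mathcal A)=D(A_0)$ with the graph norm $\|w\|_{D(\mathcal A)}=\|\mathcal Aw\|_H$; $V=H^1(\Omega)$ with $\|w\|_V^2=\|w\|_H^2+\kappa_m\|\nabla w\|^2_{L^2}$; with $H$ as pivot, $D(\mathcal A)\subset V\subset H\subset V'\subset D(\mathcal A)'$, and $A_0$, $\mathcal A^{-1}$ are extended by duality to $H\to D(\mathcal A)'$ and $D(\mathcal A)'\to H$. $\{\varphi_k\}_{k\ge1}$ is an $L^2$-orthonormal basis of eigenfunctions of $-A_0$ (increasing eigenvalues); $X_N=\mathrm{span}\{\varphi_1,\dots,\varphi_N\}$; $P_N\eta:=\sum_{k=1}^N\langle\eta,\varphi_k\rangle\varphi_k$ for $\eta\in D(\mathcal A)'$ (in particular on $V'$). Actuators: points $x_1,\dots,x_M\in\Omega$, $Bu=\sum_{j=1}^Mu_j\delta_{x_j}\in D(\mathcal A)'$ for $u\in\mathbb{R}^M$; the $N\times M$ matrix $(\varphi_k(x_j))$ has full row rank. $U_N:X_N\to\mathbb{R}^M$ is a fixed linear map such that $u=U_Ny^\star$ solves $\sum_ju_j\varphi_k(x_j)=-\langle A_0y^\star,\varphi_k\rangle_H$, $k=1,\dots,N$ (e.g. the minimum-norm solution). $g(y^\star):=A_0y^\star+BU_Ny^\star\in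 D(\mathcal A)'$, so $P_Ng(y^\star)=0$. Closed loop: the points and the gain $\lambda>0$ are such that $\dot z=A_0z-\lambda\sum_{j=1}^M(\mathcal A^{-1}z)(x_j)\,\delta_{x_j}$ generates an exponentially stable semigroup $\mathcal S_{\mathrm{cl}}(t)$ on $V'$; it is applied to $D(\mathcal A)'$ by its natural extension, and $\mathcal R_{\mathrm{cl}}h:=\int_0^\infty\mathcal S_{\mathrm{cl}}(s)h\,ds$ is a bounded operator $D(\mathcal A)'\to V'$. The bias map is $\mathcal Z_N(y^\star):=\mathcal R_{\mathrm{cl}}\,g(y^\star)\in V'$, which is linear in $y^\star\in X_N$. (The vector $y_\infty(y^\star)$ is the limit in $V'$ of the closed-loop state when the commanded reference is $y^\star$.) *)

theory Defs
  imports "HOL-Analysis.Analysis"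
begin

section \<open>Differentiability classes and domains of class C2\<close>

definition partial :: "3 \<Rightarrow> (real^3 \<Rightarrow> real) \<Rightarrow> real^3 \<Rightarrow> real" where
  "partial i f p = frechet_derivative f (at p) (axis i 1)"

primrec C_k_on :: "nat \<Rightarrow> (real^3) set \<Rightarrow> (real^3 \<Rightarrow> real) \<Rightarrow> bool" where
  "C_k_on 0 S f \<longleftrightarrow> continuous_on S f"
| "C_k_on (Suc k) S f \<longleftrightarrow> (\<forall>p\<in>S. f differentiable (at p)) \<and> (\<forall>i. C_k_on k S (partial i f))"

definition grad :: "(real^3 \<Rightarrow> real) \<Rightarrow> real^3 \<Rightarrow> real^3" where
  "grad f p = (\<chi> i. partial i f p)"

definition C2_chart :: "(real^3) set \<Rightarrow> real^3 \<Rightarrow> (real^3) set \<Rightarrow> (real^3 \<Rightarrow> real) \<Rightarrow> bool" where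
  "C2_chart \<Omega> p U \<rho> \<longleftrightarrow> open U \<and> p \<in> U \<and> C_k_on 2 U \<rho> \<and> (\<forall>q\<in>U. grad \<rho> q \<noteq> 0) \<and>
     \<Omega> \<inter> U = {q \<in> U. \<rho> q < 0}"

definition bounded_C2_domain :: "(real^3) set \<Rightarrow> bool" where
  "bounded_C2_domain \<Omega> \<longleftrightarrow> open \<Omega> \<and> \<Omega> \<noteq> {} \<and> connected \<Omega> \<and> bounded \<Omega> \<and>
     (\<forall>p\<in>frontier \<Omega>. \<exists>U \<rho>. C2_chart \<Omega> p U \<rho>)"

definition outward_normal :: "(real^3) set \<Rightarrow> real^3 \<Rightarrow> real^3" where
  "outward_normal \<Omega> p = (SOME n. \<exists>U \<rho>. C2_chart \<Omega> p U \<rho> \<and> n = grad \<rho> p /\<^sub>R norm (grad \<rho> p))"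

text \<open>Two-dimensional Hausdorff (outer) measure and the induced surface measure on the boundary.\<close>

definition hausdorff2 :: "(real^3) set \<Rightarrow> ennreal" where
  "hausdorff2 A = (SUP \<delta>\<in>{0<..}. INF C \<in> {C :: nat \<Rightarrow> (real^3) set. A \<subseteq> (\<Union>i. C i) \<and>
      (\<forall>i. bounded (C i) \<and> diameter (C i) \<le> \<delta>)}. \<Sum>i. ennreal (pi / 4 * (diameter (C i))\<^sup>2))"

definition surface_measure :: "(real^3) set \<Rightarrow> (real^3) measure" where
  "surface_measure \<Omega> = restrict_space (measure_of UNIV (sets borel) hausdorff2) (frontier \<Omega>)"


section \<open>Function spaces on the domain\<close>

text \<open>Elements of L2, H1, H2 are represented by functions; equality in these spaces is equality
  almost everywhere on the domain. Values outside the domain are irrelevant.\<close>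

definition L2 :: "(real^3) set \<Rightarrow> (real^3 \<Rightarrow> real) set" where
  "L2 \<Omega> = {f. f \<in> borel_measurable (lebesgue_on \<Omega>) \<and> integrable (lebesgue_on \<Omega>) (\<lambda>p. (f p)\<^sup>2)}"

definition ip :: "(real^3) set \<Rightarrow> (real^3 \<Rightarrow> real) \<Rightarrow> (real^3 \<Rightarrow> real) \<Rightarrow> real" where
  "ip \<Omega> f g = (LINT p|lebesgue_on \<Omega>. f p * g p)"

definition L2_norm :: "(real^3) set \<Rightarrow> (real^3 \<Rightarrow> real) \<Rightarrow> real" where
  "L2_norm \<Omega> f = sqrt (ip \<Omega> f f)"

definition test_function :: "(real^3) set \<Rightarrow> (real^3 \<Rightarrow> real) \<Rightarrow> bool" where
  "test_function \<Omega> \<psi> \<longleftrightarrow> (\<forall>k. C_k_on k UNIV \<psi>) \<and>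
     compact (closure {p. \<psi> p \<noteq> 0}) \<and> closure {p. \<psi> p \<noteq> 0} \<subseteq> \<Omega>"

definition weak_partial :: "(real^3) set \<Rightarrow> 3 \<Rightarrow> (real^3 \<Rightarrow> real) \<Rightarrow> (real^3 \<Rightarrow> real) \<Rightarrow> bool" where
  "weak_partial \<Omega> i f g \<longleftrightarrow> (\<forall>\<psi>. test_function \<Omega> \<psi> \<longrightarrow> ip \<Omega> f (partial i \<psi>) = - ip \<Omega> g \<psi>)"

definition wd :: "(real^3) set \<Rightarrow> 3 \<Rightarrow> (real^3 \<Rightarrow> real) \<Rightarrow> real^3 \<Rightarrow> real" where
  "wd \<Omega> i f = (SOME g. g \<in> L2 \<Omega> \<and> weak_partial \<Omega> i f g)"

definition H1 :: "(real^3) set \<Rightarrow> (real^3 \<Rightarrow> real) set" where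
  "H1 \<Omega> = {f \<in> L2 \<Omega>. \<forall>i. \<exists>g\<in>L2 \<Omega>. weak_partial \<Omega> i f g}"

definition H2 :: "(real^3) set \<Rightarrow> (real^3 \<Rightarrow> real) set" where
  "H2 \<Omega> = {f \<in> H1 \<Omega>. \<forall>i. wd \<Omega> i f \<in> H1 \<Omega>}"

definition V_norm :: "(real^3) set \<Rightarrow> real \<Rightarrow> (real^3 \<Rightarrow> real) \<Rightarrow> real" where
  "V_norm \<Omega> \<kappa> f = sqrt ((L2_norm \<Omega> f)\<^sup>2 + \<kappa> * (\<Sum>i\<in>UNIV. (L2_norm \<Omega> (wd \<Omega> i f))\<^sup>2))"

text \<open>Graph of the trace operator: the continuous extension to H1 of the restriction of C1 functions
  to the boundary, with values in L2 of the boundary.\<close>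

definition has_trace :: "(real^3) set \<Rightarrow> (real^3 \<Rightarrow> real) \<Rightarrow> (real^3 \<Rightarrow> real) \<Rightarrow> bool" where
  "has_trace \<Omega> f t \<longleftrightarrow> f \<in> H1 \<Omega> \<and> t \<in> borel_measurable (surface_measure \<Omega>) \<and>
     (\<exists>u :: nat \<Rightarrow> real^3 \<Rightarrow> real. (\<forall>n. C_k_on 1 UNIV (u n)) \<and>
        (\<lambda>n. V_norm \<Omega> 1 (\<lambda>p. u n p - f p)) \<longlonglongrightarrow> 0 \<and>
        (\<lambda>n. \<integral>\<^sup>+ p. ennreal ((u n p - t p)\<^sup>2) \<partial>surface_measure \<Omega>) \<longlonglongrightarrow> 0)"

definition normal_derivative_zero :: "(real^3) set \<Rightarrow> (real^3 \<Rightarrow> real) \<Rightarrow> bool" where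
  "normal_derivative_zero \<Omega> f \<longleftrightarrow> (\<exists>t. (\<forall>i. has_trace \<Omega> (wd \<Omega> i f) (t i)) \<and>
     (AE p in surface_measure \<Omega>. (\<Sum>i\<in>UNIV. t i p * outward_normal \<Omega> p $ i) = 0))"


section \<open>The Neumann operator\<close>

definition DA :: "(real^3) set \<Rightarrow> (real^3 \<Rightarrow> real) set" where
  "DA \<Omega> = {y \<in> H2 \<Omega>. normal_derivative_zero \<Omega> y}"

definition A0 :: "(real^3) set \<Rightarrow> real \<Rightarrow> (real^3 \<Rightarrow> real) \<Rightarrow> real^3 \<Rightarrow> real" where
  "A0 \<Omega> \<kappa> y = (\<lambda>p. \<kappa> * (\<Sum>i\<in>UNIV. wd \<Omega> i (wd \<Omega> i y) p))"

definition Acal :: "(real^3) set \<Rightarrow> real \<Rightarrow> (real^3 \<Rightarrow> real) \<Rightarrow> real^3 \<Rightarrow> real" where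
  "Acal \<Omega> \<kappa> y = (\<lambda>p. y p - A0 \<Omega> \<kappa> y p)"

definition DA_norm :: "(real^3) set \<Rightarrow> real \<Rightarrow> (real^3 \<Rightarrow> real) \<Rightarrow> real" where
  "DA_norm \<Omega> \<kappa> w = L2_norm \<Omega> (Acal \<Omega> \<kappa> w)"


section \<open>Duality\<close>

definition lincomb :: "real \<Rightarrow> ('a \<Rightarrow> real) \<Rightarrow> real \<Rightarrow> ('a \<Rightarrow> real) \<Rightarrow> 'a \<Rightarrow> real" where
  "lincomb a f b g = (\<lambda>x. a * f x + b * g x)"

text \<open>Topological dual of a (semi)normed space of functions. A functional is set to zero outside its
  domain, so that equality of functionals on the space is equality in HOL. Boundedness with respect
  to the norm makes a functional depend only on almost-everywhere classes.\<close>

definition dual :: "('a \<Rightarrow> real) set \<Rightarrow> (('a \<Rightarrow> real) \<Rightarrow> real) \<Rightarrow> (('a \<Rightarrow> real) \<Rightarrow> real) set" where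
  "dual E nrm = {\<eta>. (\<forall>w. w \<notin> E \<longrightarrow> \<eta> w = 0) \<and>
     (\<forall>a b. \<forall>v\<in>E. \<forall>w\<in>E. \<eta> (lincomb a v b w) = a * \<eta> v + b * \<eta> w) \<and>
     (\<exists>C. \<forall>w\<in>E. \<bar>\<eta> w\<bar> \<le> C * nrm w)}"

definition dual_norm ::
  "('a \<Rightarrow> real) set \<Rightarrow> (('a \<Rightarrow> real) \<Rightarrow> real) \<Rightarrow> (('a \<Rightarrow> real) \<Rightarrow> real) \<Rightarrow> real" where
  "dual_norm E nrm \<eta> = (SUP w\<in>{w \<in> E. nrm w \<le> 1}. \<bar>\<eta> w\<bar>)"

definition restr :: "('a \<Rightarrow> real) set \<Rightarrow> (('a \<Rightarrow> real) \<Rightarrow> real) \<Rightarrow> ('a \<Rightarrow> real) \<Rightarrow> real" where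
  "restr E \<eta> = (\<lambda>w. if w \<in> E then \<eta> w else 0)"

definition V_dual :: "(real^3) set \<Rightarrow> real \<Rightarrow> ((real^3 \<Rightarrow> real) \<Rightarrow> real) set" where
  "V_dual \<Omega> \<kappa> = dual (H1 \<Omega>) (V_norm \<Omega> \<kappa>)"

definition V_dual_norm :: "(real^3) set \<Rightarrow> real \<Rightarrow> ((real^3 \<Rightarrow> real) \<Rightarrow> real) \<Rightarrow> real" where
  "V_dual_norm \<Omega> \<kappa> = dual_norm (H1 \<Omega>) (V_norm \<Omega> \<kappa>)"

definition DA_dual :: "(real^3) set \<Rightarrow> real \<Rightarrow> ((real^3 \<Rightarrow> real) \<Rightarrow> real) set" where
  "DA_dual \<Omega> \<kappa> = dual (DA \<Omega>) (DA_norm \<Omega> \<kappa>)"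

definition DA_dual_norm :: "(real^3) set \<Rightarrow> real \<Rightarrow> ((real^3 \<Rightarrow> real) \<Rightarrow> real) \<Rightarrow> real" where
  "DA_dual_norm \<Omega> \<kappa> = dual_norm (DA \<Omega>) (DA_norm \<Omega> \<kappa>)"

text \<open>Pivot embeddings of L2 into the dual of a subspace \<open>E\<close> (\<open>E\<close> is H1 or the operator domain). The
  inclusion of the dual of H1 in the dual of the operator domain is \<open>restr (DA \<Omega>)\<close>.\<close>

definition pivot :: "(real^3) set \<Rightarrow> (real^3 \<Rightarrow> real) set \<Rightarrow> (real^3 \<Rightarrow> real) \<Rightarrow> (real^3 \<Rightarrow> real) \<Rightarrow> real" where
  "pivot \<Omega> E y = restr E (ip \<Omega> y)"

definition A0_ext :: "(real^3) set \<Rightarrow> real \<Rightarrow> (real^3 \<Rightarrow> real) \<Rightarrow> (real^3 \<Rightarrow> real) \<Rightarrow> real" where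
  "A0_ext \<Omega> \<kappa> y = restr (DA \<Omega>) (\<lambda>w. ip \<Omega> y (A0 \<Omega> \<kappa> w))"

text \<open>Extension of the inverse of \<open>Acal\<close> by duality: the defining identity \<open>(v, h) = z (Acal\<inverse> h)\<close> for
  \<open>h\<close> in L2 is written with \<open>h = Acal w\<close>.\<close>

definition Ainv_ext :: "(real^3) set \<Rightarrow> real \<Rightarrow> ((real^3 \<Rightarrow> real) \<Rightarrow> real) \<Rightarrow> real^3 \<Rightarrow> real" where
  "Ainv_ext \<Omega> \<kappa> z = (SOME v. v \<in> L2 \<Omega> \<and> (\<forall>w\<in>DA \<Omega>. ip \<Omega> v (Acal \<Omega> \<kappa> w) = z w))"

text \<open>Value at a point of the continuous representative (which exists for H2 functions in dimension 3).\<close>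

definition pt_eval :: "(real^3) set \<Rightarrow> (real^3 \<Rightarrow> real) \<Rightarrow> real^3 \<Rightarrow> real" where
  "pt_eval \<Omega> w p = (SOME v. continuous_on \<Omega> v \<and> (AE q in lebesgue_on \<Omega>. v q = w q)) p"

definition delta :: "(real^3) set \<Rightarrow> real^3 \<Rightarrow> (real^3 \<Rightarrow> real) \<Rightarrow> real" where
  "delta \<Omega> p = restr (DA \<Omega>) (\<lambda>w. pt_eval \<Omega> w p)"

definition actuation ::
  "(real^3) set \<Rightarrow> ('m::finite \<Rightarrow> real^3) \<Rightarrow> real^'m \<Rightarrow> (real^3 \<Rightarrow> real) \<Rightarrow> real" where
  "actuation \<Omega> x u = (\<lambda>w. \<Sum>j\<in>UNIV. u $ j * delta \<Omega> (x j) w)"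


section \<open>Eigenfunctions and spectral projection\<close>

text \<open>Indices start at 1; the entries with index 0 are not used.\<close>

definition neumann_eigenbasis ::
  "(real^3) set \<Rightarrow> real \<Rightarrow> (nat \<Rightarrow> real^3 \<Rightarrow> real) \<Rightarrow> (nat \<Rightarrow> real) \<Rightarrow> bool" where
  "neumann_eigenbasis \<Omega> \<kappa> \<phi> \<mu> \<longleftrightarrow>
     (\<forall>k\<ge>1. \<phi> k \<in> DA \<Omega> \<and> (AE p in lebesgue_on \<Omega>. - A0 \<Omega> \<kappa> (\<phi> k) p = \<mu> k * \<phi> k p)) \<and>
     (\<forall>k\<ge>1. \<mu> k \<le> \<mu> (Suc k)) \<and>
     (\<forall>k\<ge>1. \<forall>l\<ge>1. ip \<Omega> (\<phi> k) (\<phi> l) = (if k = l then 1 else 0)) \<and>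
     (\<forall>f\<in>L2 \<Omega>. (\<lambda>n. L2_norm \<Omega> (\<lambda>p. f p - (\<Sum>k=1..n. ip \<Omega> f (\<phi> k) * \<phi> k p))) \<longlonglongrightarrow> 0)"

definition XN :: "(nat \<Rightarrow> real^3 \<Rightarrow> real) \<Rightarrow> nat \<Rightarrow> (real^3 \<Rightarrow> real) set" where
  "XN \<phi> N = {y. \<exists>c. y = (\<lambda>p. \<Sum>k=1..N. c k * \<phi> k p)}"

definition PN ::
  "(nat \<Rightarrow> real^3 \<Rightarrow> real) \<Rightarrow> nat \<Rightarrow> ((real^3 \<Rightarrow> real) \<Rightarrow> real) \<Rightarrow> real^3 \<Rightarrow> real" where
  "PN \<phi> N \<eta> = (\<lambda>p. \<Sum>k=1..N. \<eta> (\<phi> k) * \<phi> k p)"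

text \<open>A fixed linear choice of steady inputs.\<close>

definition steady_input ::
  "(real^3) set \<Rightarrow> real \<Rightarrow> (nat \<Rightarrow> real^3 \<Rightarrow> real) \<Rightarrow> nat \<Rightarrow> ('m::finite \<Rightarrow> real^3) \<Rightarrow>
     ((real^3 \<Rightarrow> real) \<Rightarrow> real^'m) \<Rightarrow> bool" where
  "steady_input \<Omega> \<kappa> \<phi> N x U \<longleftrightarrow>
     (\<forall>a b. \<forall>y\<in>XN \<phi> N. \<forall>z\<in>XN \<phi> N. U (lincomb a y b z) = a *\<^sub>R U y + b *\<^sub>R U z) \<and>
     (\<forall>y\<in>XN \<phi> N. \<forall>k\<in>{1..N}.
        (\<Sum>j\<in>UNIV. U y $ j * pt_eval \<Omega> (\<phi> k) (x j)) = - ip \<Omega> (A0 \<Omega> \<kappa> y) (\<phi> k))"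

definition residual_forcing ::
  "(real^3) set \<Rightarrow> real \<Rightarrow> ('m::finite \<Rightarrow> real^3) \<Rightarrow> ((real^3 \<Rightarrow> real) \<Rightarrow> real^'m) \<Rightarrow>
     (real^3 \<Rightarrow> real) \<Rightarrow> (real^3 \<Rightarrow> real) \<Rightarrow> real" where
  "residual_forcing \<Omega> \<kappa> x U y = (\<lambda>w. A0_ext \<Omega> \<kappa> y w + actuation \<Omega> x (U y) w)"


section \<open>Closed-loop semigroup\<close>

definition bounded_linear_on ::
  "('a \<Rightarrow> real) set \<Rightarrow> (('a \<Rightarrow> real) \<Rightarrow> real) \<Rightarrow> ('b \<Rightarrow> real) set \<Rightarrow> (('b \<Rightarrow> real) \<Rightarrow> real) \<Rightarrow>
     (('a \<Rightarrow> real) \<Rightarrow> 'b \<Rightarrow> real) \<Rightarrow> bool" where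
  "bounded_linear_on E nE F nF T \<longleftrightarrow> (\<forall>z\<in>E. T z \<in> F) \<and>
     (\<forall>a b. \<forall>y\<in>E. \<forall>z\<in>E. T (lincomb a y b z) = lincomb a (T y) b (T z)) \<and>
     (\<exists>C. \<forall>z\<in>E. nF (T z) \<le> C * nE z)"

definition c0_semigroup ::
  "('a \<Rightarrow> real) set \<Rightarrow> (('a \<Rightarrow> real) \<Rightarrow> real) \<Rightarrow> (real \<Rightarrow> ('a \<Rightarrow> real) \<Rightarrow> 'a \<Rightarrow> real) \<Rightarrow> bool" where
  "c0_semigroup E nE S \<longleftrightarrow> (\<forall>t\<ge>0. bounded_linear_on E nE E nE (S t)) \<and>
     (\<forall>z\<in>E. S 0 z = z) \<and> (\<forall>s\<ge>0. \<forall>t\<ge>0. \<forall>z\<in>E. S (s + t) z = S s (S t z)) \<and>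
     (\<forall>z\<in>E. ((\<lambda>t. nE (\<lambda>w. S t z w - z w)) \<longlongrightarrow> 0) (at_right 0))"

definition exp_stable ::
  "('a \<Rightarrow> real) set \<Rightarrow> (('a \<Rightarrow> real) \<Rightarrow> real) \<Rightarrow> (real \<Rightarrow> ('a \<Rightarrow> real) \<Rightarrow> 'a \<Rightarrow> real) \<Rightarrow> bool" where
  "exp_stable E nE S \<longleftrightarrow>
     (\<exists>C. \<exists>\<omega>>0. \<forall>t\<ge>0. \<forall>z\<in>E. nE (S t z) \<le> C * exp (- \<omega> * t) * nE z)"

definition A_cl ::
  "(real^3) set \<Rightarrow> real \<Rightarrow> ('m::finite \<Rightarrow> real^3) \<Rightarrow> real \<Rightarrow> (real^3 \<Rightarrow> real) \<Rightarrow> (real^3 \<Rightarrow> real) \<Rightarrow> real" where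
  "A_cl \<Omega> \<kappa> x gain v = (\<lambda>w. A0_ext \<Omega> \<kappa> v w
     - gain * (\<Sum>j\<in>UNIV. pt_eval \<Omega> (Ainv_ext \<Omega> \<kappa> (pivot \<Omega> (DA \<Omega>) v)) (x j) * delta \<Omega> (x j) w))"

text \<open>\<open>S\<close> is generated on the dual of H1 by the part of \<open>A_cl\<close> in that space. \<open>A_cl\<close> maps L2 to the dual
  of the operator domain; the point values of \<open>Ainv_ext z\<close> are only defined for \<open>z\<close> more regular than
  the dual of H1, so the domain of the generator consists of the \<open>z\<close> in L2 with \<open>A_cl z\<close> in
  the dual of H1. \<open>f\<close> below is the value of the generator at \<open>z\<close>.\<close>

definition closed_loop_semigroup ::
  "(real^3) set \<Rightarrow> real \<Rightarrow> ('m::finite \<Rightarrow> real^3) \<Rightarrow> real \<Rightarrow>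
     (real \<Rightarrow> ((real^3 \<Rightarrow> real) \<Rightarrow> real) \<Rightarrow> (real^3 \<Rightarrow> real) \<Rightarrow> real) \<Rightarrow> bool" where
  "closed_loop_semigroup \<Omega> \<kappa> x gain S \<longleftrightarrow> c0_semigroup (V_dual \<Omega> \<kappa>) (V_dual_norm \<Omega> \<kappa>) S \<and>
     (\<forall>z\<in>V_dual \<Omega> \<kappa>. \<forall>f\<in>V_dual \<Omega> \<kappa>.
        ((\<lambda>t. V_dual_norm \<Omega> \<kappa> (\<lambda>w. (S t z w - z w) / t - f w)) \<longlongrightarrow> 0) (at_right 0) \<longleftrightarrow>
        (\<exists>v\<in>L2 \<Omega>. z = pivot \<Omega> (H1 \<Omega>) v \<and> restr (DA \<Omega>) f = A_cl \<Omega> \<kappa> x gain v))"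

definition semigroup_extension ::
  "(real^3) set \<Rightarrow> real \<Rightarrow>
     (real \<Rightarrow> ((real^3 \<Rightarrow> real) \<Rightarrow> real) \<Rightarrow> (real^3 \<Rightarrow> real) \<Rightarrow> real) \<Rightarrow>
     (real \<Rightarrow> ((real^3 \<Rightarrow> real) \<Rightarrow> real) \<Rightarrow> (real^3 \<Rightarrow> real) \<Rightarrow> real) \<Rightarrow> bool" where
  "semigroup_extension \<Omega> \<kappa> S Sx \<longleftrightarrow> c0_semigroup (DA_dual \<Omega> \<kappa>) (DA_dual_norm \<Omega> \<kappa>) Sx \<and>
     (\<forall>t\<ge>0. \<forall>z\<in>V_dual \<Omega> \<kappa>. Sx t (restr (DA \<Omega>) z) = restr (DA \<Omega>) (S t z))"

text \<open>Integral over \<open>[0,\<infinity>)\<close> of a path \<open>F\<close> in \<open>(E, nE)\<close>, as the limit of integrals over \<open>[0,b]\<close>. The latter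
  unfold the library's \<open>has_integral\<close>, whose type-class norm is replaced by \<open>nE\<close>; for the continuous
  orbits considered here this is the Riemann integral.\<close>

definition has_integral_to ::
  "(('a \<Rightarrow> real) \<Rightarrow> real) \<Rightarrow> (real \<Rightarrow> 'a \<Rightarrow> real) \<Rightarrow> real \<Rightarrow> ('a \<Rightarrow> real) \<Rightarrow> bool" where
  "has_integral_to nE F b I \<longleftrightarrow>
     ((\<lambda>p. nE (\<lambda>w. (\<Sum>(s,K)\<in>p. measure lborel K * F s w) - I w)) \<longlongrightarrow> 0) (division_filter (cbox 0 b))"

definition has_improper_integral ::
  "('a \<Rightarrow> real) set \<Rightarrow> (('a \<Rightarrow> real) \<Rightarrow> real) \<Rightarrow> (real \<Rightarrow> 'a \<Rightarrow> real) \<Rightarrow> ('a \<Rightarrow> real) \<Rightarrow> bool" where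
  "has_improper_integral E nE F I \<longleftrightarrow> I \<in> E \<and>
     (\<exists>J. (\<forall>b\<ge>0. J b \<in> E \<and> has_integral_to nE F b (J b)) \<and>
          ((\<lambda>b. nE (\<lambda>w. J b w - I w)) \<longlongrightarrow> 0) at_top)"

definition is_orbit_integral ::
  "(real^3) set \<Rightarrow> real \<Rightarrow>
     (real \<Rightarrow> ((real^3 \<Rightarrow> real) \<Rightarrow> real) \<Rightarrow> (real^3 \<Rightarrow> real) \<Rightarrow> real) \<Rightarrow>
     ((real^3 \<Rightarrow> real) \<Rightarrow> real) \<Rightarrow> ((real^3 \<Rightarrow> real) \<Rightarrow> real) \<Rightarrow> bool" where
  "is_orbit_integral \<Omega> \<kappa> Sx h r \<longleftrightarrow> r \<in> V_dual \<Omega> \<kappa> \<and>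
     has_improper_integral (DA_dual \<Omega> \<kappa>) (DA_dual_norm \<Omega> \<kappa>) (\<lambda>s. Sx s h) (restr (DA \<Omega>) r)"

definition R_cl ::
  "(real^3) set \<Rightarrow> real \<Rightarrow>
     (real \<Rightarrow> ((real^3 \<Rightarrow> real) \<Rightarrow> real) \<Rightarrow> (real^3 \<Rightarrow> real) \<Rightarrow> real) \<Rightarrow>
     ((real^3 \<Rightarrow> real) \<Rightarrow> real) \<Rightarrow> (real^3 \<Rightarrow> real) \<Rightarrow> real" where
  "R_cl \<Omega> \<kappa> Sx h = (SOME r. is_orbit_integral \<Omega> \<kappa> Sx h r)"

definition bias_map ::
  "(real^3) set \<Rightarrow> real \<Rightarrow> ('m::finite \<Rightarrow> real^3) \<Rightarrow> ((real^3 \<Rightarrow> real) \<Rightarrow> real^'m) \<Rightarrow>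
     (real \<Rightarrow> ((real^3 \<Rightarrow> real) \<Rightarrow> real) \<Rightarrow> (real^3 \<Rightarrow> real) \<Rightarrow> real) \<Rightarrow>
     (real^3 \<Rightarrow> real) \<Rightarrow> (real^3 \<Rightarrow> real) \<Rightarrow> real" where
  "bias_map \<Omega> \<kappa> x U Sx y = R_cl \<Omega> \<kappa> Sx (residual_forcing \<Omega> \<kappa> x U y)"

definition projected_bias ::
  "(real^3) set \<Rightarrow> real \<Rightarrow> (nat \<Rightarrow> real^3 \<Rightarrow> real) \<Rightarrow> nat \<Rightarrow> ('m::finite \<Rightarrow> real^3) \<Rightarrow>
     ((real^3 \<Rightarrow> real) \<Rightarrow> real^'m) \<Rightarrow>
     (real \<Rightarrow> ((real^3 \<Rightarrow> real) \<Rightarrow> real) \<Rightarrow> (real^3 \<Rightarrow> real) \<Rightarrow> real) \<Rightarrow>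
     (real^3 \<Rightarrow> real) \<Rightarrow> real^3 \<Rightarrow> real" where
  "projected_bias \<Omega> \<kappa> \<phi> N x U Sx y = PN \<phi> N (bias_map \<Omega> \<kappa> x U Sx y)"

definition y_inf ::
  "(real^3) set \<Rightarrow> real \<Rightarrow> ('m::finite \<Rightarrow> real^3) \<Rightarrow> ((real^3 \<Rightarrow> real) \<Rightarrow> real^'m) \<Rightarrow>
     (real \<Rightarrow> ((real^3 \<Rightarrow> real) \<Rightarrow> real) \<Rightarrow> (real^3 \<Rightarrow> real) \<Rightarrow> real) \<Rightarrow>
     (real^3 \<Rightarrow> real) \<Rightarrow> (real^3 \<Rightarrow> real) \<Rightarrow> real" where
  "y_inf \<Omega> \<kappa> x U Sx y = (\<lambda>w. pivot \<Omega> (H1 \<Omega>) y w + bias_map \<Omega> \<kappa> x U Sx y w)"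


section \<open>Norms, operator norms and fixed-point iteration on the finite-dimensional space\<close>

definition norm_on :: "('a \<Rightarrow> real) set \<Rightarrow> (('a \<Rightarrow> real) \<Rightarrow> real) \<Rightarrow> bool" where
  "norm_on X n \<longleftrightarrow> (\<forall>y\<in>X. 0 \<le> n y \<and> (n y = 0 \<longleftrightarrow> y = (\<lambda>_. 0))) \<and>
     (\<forall>a. \<forall>y\<in>X. n (\<lambda>p. a * y p) = \<bar>a\<bar> * n y) \<and>
     (\<forall>y\<in>X. \<forall>z\<in>X. n (\<lambda>p. y p + z p) \<le> n y + n z)"

definition op_norm ::
  "('a \<Rightarrow> real) set \<Rightarrow> (('a \<Rightarrow> real) \<Rightarrow> real) \<Rightarrow> (('a \<Rightarrow> real) \<Rightarrow> 'a \<Rightarrow> real) \<Rightarrow> real" where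
  "op_norm X n T = (SUP y\<in>{y \<in> X. n y \<le> 1}. n (T y))"

primrec picard :: "(('a \<Rightarrow> real) \<Rightarrow> 'a \<Rightarrow> real) \<Rightarrow> ('a \<Rightarrow> real) \<Rightarrow> nat \<Rightarrow> 'a \<Rightarrow> real" where
  "picard T yr 0 = yr"
| "picard T yr (Suc l) = (\<lambda>p. yr p - T (picard T yr l) p)"

text \<open>Quantifying over all norms makes the notion intrinsic to the finite-dimensional space \<open>X\<close>.\<close>

definition converges_geometrically ::
  "('a \<Rightarrow> real) set \<Rightarrow> (nat \<Rightarrow> 'a \<Rightarrow> real) \<Rightarrow> ('a \<Rightarrow> real) \<Rightarrow> bool" where
  "converges_geometrically X ys y \<longleftrightarrow> (\<forall>l. ys l \<in> X) \<and> y \<in> X \<and>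
     (\<forall>n. norm_on X n \<longrightarrow> (\<exists>C q. 0 \<le> q \<and> q < 1 \<and> (\<forall>l. n (\<lambda>p. ys l p - y p) \<le> C * q ^ l)))"

end

theory Submission
  imports Defs
begin

text \<open>The solution of the fixed-point equation is reproduced by the projection because
  \<open>P\<^sub>N\<close> is the identity on \<open>X\<^sub>N\<close> by orthonormality. The Picard error satisfies
  \<open>e\<^bsub>l+1\<^esub> = - T\<^sub>N e\<^sub>l\<close>, so it decays like \<open>\<parallel>T\<^sub>N\<parallel>\<^sup>l\<close> in the given norm, and in any other norm by
  the equivalence of norms on a finite-dimensional space.\<close>

section \<open>Norms on finite-dimensional function spaces\<close>

text \<open>Coefficients are total functions, so those outside \<open>I\<close> are irrelevant and
  the coordinates of a vector are determined at most on \<open>I\<close>; independence is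
  accordingly stated on \<open>I\<close> only. The family stays abstract so that the norm arguments
  do not involve the eigenfunctions.\<close>

definition fin_comb :: "'i set \<Rightarrow> ('i \<Rightarrow> 'a \<Rightarrow> real) \<Rightarrow> ('i \<Rightarrow> real) \<Rightarrow> 'a \<Rightarrow> real" where
  "fin_comb I b c = (\<lambda>p. \<Sum>k\<in>I. c k * b k p)"

text \<open>Phrased with \<open>lincomb\<close> to match \<open>bounded_linear_on\<close> and
  \<open>steady_input\<close>, and relative to a set because the operators concerned are total
  functions about which little is known outside their domains.\<close>

definition linear_on_set ::
  "('a \<Rightarrow> real) set \<Rightarrow> (('a \<Rightarrow> real) \<Rightarrow> 'b \<Rightarrow> real) \<Rightarrow> bool" where
  "linear_on_set X T \<longleftrightarrow>
     (\<forall>a b. \<forall>y\<in>X. \<forall>z\<in>X. T (lincomb a y b z) = lincomb a (T y) b (T z))"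

lemma linear_on_setD:
  "linear_on_set X T \<Longrightarrow> y \<in> X \<Longrightarrow> z \<in> X \<Longrightarrow>
     T (lincomb a y b z) = lincomb a (T y) b (T z)"
  unfolding linear_on_set_def by blast

section \<open>Spans in coordinates and their closure properties\<close>

lemma XN_eq_range: "XN \<phi> N = range (fin_comb {1..N} \<phi>)"
  by (auto simp: XN_def fin_comb_def)

lemma lincomb_fin_comb:
  "lincomb a (fin_comb I b c) d (fin_comb I b e) = fin_comb I b (\<lambda>k. a * c k + d * e k)"
  by (auto simp: lincomb_def fin_comb_def sum_distrib_left algebra_simps sum.distrib)

lemma lincomb_in_range:
  assumes "y \<in> range (fin_comb I b)" "z \<in> range (fin_comb I b)"
  shows "lincomb a y d z \<in> range (fin_comb I b)"
  using assms by (auto simp: lincomb_fin_comb)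

lemma scale_in_range:
  assumes "y \<in> range (fin_comb I b)" shows "(\<lambda>p. a * y p) \<in> range (fin_comb I b)"
  using lincomb_in_range[OF assms assms, of a 0] by (simp add: lincomb_def)

lemma diff_in_range:
  assumes "y \<in> range (fin_comb I b)" "z \<in> range (fin_comb I b)"
  shows "(\<lambda>p. y p - z p) \<in> range (fin_comb I b)"
  using lincomb_in_range[OF assms, of 1 "-1"] by (simp add: lincomb_def)

lemma zero_in_range: "(\<lambda>_. 0) \<in> range (fin_comb I b)"
  by (rule range_eqI[of _ _ "\<lambda>_. 0"]) (simp add: fin_comb_def)

lemma basis_in_range:
  assumes "finite I" "k \<in> I" shows "b k \<in> range (fin_comb I b)"
  using assms
  by (intro range_eqI[of _ _ "\<lambda>j. if j = k then 1 else 0"])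
     (auto simp: fin_comb_def if_distrib[of "\<lambda>t. t * _"] cong: if_cong)

section \<open>Consequences of the norm axioms and equivalence of norms\<close>

lemma norm_on_nonneg: "norm_on X n \<Longrightarrow> y \<in> X \<Longrightarrow> 0 \<le> n y"
  unfolding norm_on_def by blast

lemma norm_on_eq_0_iff: "norm_on X n \<Longrightarrow> y \<in> X \<Longrightarrow> n y = 0 \<longleftrightarrow> y = (\<lambda>_. 0)"
  unfolding norm_on_def by blast

lemma norm_on_scale: "norm_on X n \<Longrightarrow> y \<in> X \<Longrightarrow> n (\<lambda>p. a * y p) = \<bar>a\<bar> * n y"
  unfolding norm_on_def by blast

lemma norm_on_triangle:
  "norm_on X n \<Longrightarrow> y \<in> X \<Longrightarrow> z \<in> X \<Longrightarrow> n (\<lambda>p. y p + z p) \<le> n y + n z"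
  unfolding norm_on_def by blast

text \<open>The triangle inequality, one basis vector at a time. It is used twice: with the identity
  for \<open>T\<close> it gives continuity of a norm in the coordinates, with general
  \<open>T\<close> the boundedness of \<open>T\<close>. The induction truncates coefficients to
  \<open>J\<close> but keeps the sum over \<open>I\<close>, so every partial sum stays in the same
  span.\<close>

lemma norm_on_fin_comb_le:
  assumes fin: "finite I" and n: "norm_on X n"
    and lin: "linear_on_set (range (fin_comb I b)) T" and T: "T ` range (fin_comb I b) \<subseteq> X"
  shows "n (T (fin_comb I b c)) \<le> (\<Sum>k\<in>I. \<bar>c k\<bar> * n (T (b k)))"
proof -
  let ?R = "range (fin_comb I b)"
  have "n (T (fin_comb I b (\<lambda>k. if k \<in> J then c k else 0))) \<le> (\<Sum>k\<in>J. \<bar>c k\<bar> * n (T (b k)))"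
    if "J \<subseteq> I" for J
    using finite_subset[OF that fin] that
  proof (induction J)
    case empty
    \<comment> \<open>Linearity is available only through \<open>lincomb\<close>; the trivial
      combination gives \<open>T 0 = 0\<close>.\<close>
    have "T (lincomb 0 (\<lambda>_. 0) 0 (\<lambda>_. 0)) = lincomb 0 (T (\<lambda>_. 0)) 0 (T (\<lambda>_. 0))"
      by (rule linear_on_setD[OF lin zero_in_range zero_in_range])
    then have "T (\<lambda>_. 0) = (\<lambda>_. 0)" by (simp add: lincomb_def)
    moreover have "T (\<lambda>_. 0) \<in> X" using T zero_in_range by blast
    ultimately have "n (T (\<lambda>_. 0)) = 0" using norm_on_eq_0_iff[OF n] by blast
    then show ?case by (simp add: fin_comb_def)
  next
    case (insert k J)
    let ?y = "fin_comb I b (\<lambda>k. if k \<in> J then c k else 0)"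
    have bk: "b k \<in> ?R" using basis_in_range[OF fin, of k b] insert.prems by simp
    have y: "?y \<in> ?R" by blast
    have "fin_comb I b (\<lambda>i. if i \<in> insert k J then c i else 0) = lincomb (c k) (b k) 1 ?y"
    proof
      fix p
      have "(\<Sum>i\<in>I. (if i \<in> insert k J then c i else 0) * b i p)
          = (\<Sum>i\<in>I. (if i = k then c k * b k p else 0) + (if i \<in> J then c i else 0) * b i p)"
        using insert.hyps by (intro sum.cong) auto
      also have "\<dots> = c k * b k p + (\<Sum>i\<in>I. (if i \<in> J then c i else 0) * b i p)"
        using fin insert.prems by (simp add: sum.distrib)
      finally show "fin_comb I b (\<lambda>i. if i \<in> insert k J then c i else 0) p = lincomb (c k) (b k) 1 ?y p"
        by (simp add: fin_comb_def lincomb_def)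
    qed
    then have eq: "T (fin_comb I b (\<lambda>i. if i \<in> insert k J then c i else 0))
        = lincomb (c k) (T (b k)) 1 (T ?y)"
      using linear_on_setD[OF lin bk y] by simp
    have mem: "T (b k) \<in> X" "T ?y \<in> X" using T bk y by blast+
    \<comment> \<open>\<open>X\<close> is not assumed closed under scaling. The multiple lies in
      \<open>X\<close> because it is the image of a multiple of \<open>b k\<close>.\<close>
    have "(\<lambda>p. c k * T (b k) p) = T (lincomb (c k) (b k) 0 (b k))"
      using linear_on_setD[OF lin bk bk, of "c k" 0] by (simp add: lincomb_def)
    then have mem2: "(\<lambda>p. c k * T (b k) p) \<in> X"
      using T lincomb_in_range[OF bk bk] by auto
    have "n (lincomb (c k) (T (b k)) 1 (T ?y)) \<le> n (\<lambda>p. c k * T (b k) p) + n (T ?y)"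
      using norm_on_triangle[OF n mem2 mem(2)] by (simp add: lincomb_def)
    also have "\<dots> \<le> \<bar>c k\<bar> * n (T (b k)) + (\<Sum>k\<in>J. \<bar>c k\<bar> * n (T (b k)))"
      using insert by (intro add_mono) (auto simp: norm_on_scale[OF n mem(1)])
    finally show ?case unfolding eq using insert.hyps by simp
  qed
  from this[OF subset_refl] show ?thesis by (simp add: fin_comb_def cong: sum.cong)
qed

text \<open>The nontrivial half of norm equivalence: on the compact l1 unit sphere of the
  coordinates the continuous function \<open>n\<close> attains a minimum, positive by independence,
  and homogeneity carries the bound to all vectors.\<close>

lemma norm_on_coordinates_le:
  assumes fin: "finite I" and n: "norm_on (range (fin_comb I b)) n"
    and indep: "\<And>c. fin_comb I b c = (\<lambda>_. 0) \<Longrightarrow> \<forall>k\<in>I. c k = 0"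
  shows "\<exists>C\<ge>0. \<forall>c. (\<Sum>k\<in>I. \<bar>c k\<bar>) \<le> C * n (fin_comb I b c)"
proof (cases "I = {}")
  \<comment> \<open>The sphere is empty when \<open>I\<close> is, so no minimum could be
    taken.\<close>
  case True
  then show ?thesis by (intro exI[of _ 0]) simp
next
  case False
  let ?f = "fin_comb I b"
  define s where "s c = (\<Sum>k\<in>I. \<bar>c k\<bar>)" for c :: "'a \<Rightarrow> real"
  \<comment> \<open>The index type may be infinite, hence the product topology and compactness of a
    product of compact sets. Pinning coordinates outside \<open>I\<close> to 0 makes
    \<open>K\<close> a copy of the l1 unit sphere over \<open>I\<close>.\<close>
  define B where "B = Pi\<^sub>E UNIV (\<lambda>k. if k \<in> I then {-1..1::real} else {0})"
  define K where "K = B \<inter> {c. s c = 1}"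
  have id_lin: "linear_on_set (range ?f) (\<lambda>y. y)" by (simp add: linear_on_set_def)
  have upper: "n (?f c) \<le> (\<Sum>k\<in>I. \<bar>c k\<bar> * n (b k))" for c
    using norm_on_fin_comb_le[OF fin n id_lin] by simp
  have nonneg: "0 \<le> n (?f c)" for c using norm_on_nonneg[OF n] by blast
  have s_cont: "continuous_on A s" for A
    unfolding s_def by (intro continuous_intros continuous_on_subset[OF continuous_on_product_coordinates]) auto
  \<comment> \<open>Reverse triangle inequality combined with \<open>upper\<close>; the right side
    tends to 0 as \<open>c\<close> tends to \<open>d\<close>, which yields continuity.\<close>
  have diff: "\<bar>n (?f c) - n (?f d)\<bar> \<le> (\<Sum>k\<in>I. \<bar>c k - d k\<bar> * n (b k))" for c d
  proof -
    have tri: "n (?f c) \<le> n (?f (\<lambda>k. c k - d k)) + n (?f d)" for c d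
    proof -
      have eq: "?f c = (\<lambda>p. ?f (\<lambda>k. c k - d k) p + ?f d p)"
        by (simp add: fin_comb_def sum_subtractf left_diff_distrib)
      have "n (\<lambda>p. ?f (\<lambda>k. c k - d k) p + ?f d p) \<le> n (?f (\<lambda>k. c k - d k)) + n (?f d)"
        using norm_on_triangle[OF n] by blast
      then show ?thesis by (simp flip: eq)
    qed
    show ?thesis
      using tri[of c d] tri[of d c] upper[of "\<lambda>k. c k - d k"] upper[of "\<lambda>k. d k - c k"]
      by (simp add: abs_minus_commute)
  qed
  have n_cont: "continuous_on A (\<lambda>c. n (?f c))" for A
    unfolding continuous_on_def
  proof
    fix d assume "d \<in> A"
    have "continuous_on A (\<lambda>c. \<Sum>k\<in>I. \<bar>c k - d k\<bar> * n (b k))"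
      by (intro continuous_intros continuous_on_subset[OF continuous_on_product_coordinates]) auto
    then have "((\<lambda>c. \<Sum>k\<in>I. \<bar>c k - d k\<bar> * n (b k)) \<longlongrightarrow> 0) (at d within A)"
      using \<open>d \<in> A\<close> unfolding continuous_on_def by fastforce
    then have "((\<lambda>c. n (?f c) - n (?f d)) \<longlongrightarrow> 0) (at d within A)"
      by (rule Lim_null_comparison[rotated]) (simp add: diff)
    then show "((\<lambda>c. n (?f c)) \<longlongrightarrow> n (?f d)) (at d within A)"
      by (rule LIM_zero_cancel)
  qed
  have "compact B"
    unfolding B_def compactin_euclidean_iff[symmetric] euclidean_product_topology[symmetric]
    by (subst compactin_PiE) auto
  moreover have "closed {c. s c = 1}"
    by (rule closed_Collect_eq) (auto intro: s_cont)
  ultimately have "compact K" unfolding K_def by (rule compact_Int_closed)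
  moreover have K_ne: "K \<noteq> {}"
  proof -
    obtain i where i: "i \<in> I" using False by blast
    have "(\<lambda>k. if k = i then 1 else 0) \<in> K"
      using i fin by (auto simp: K_def B_def s_def if_distrib[of abs] cong: if_cong)
    then show ?thesis by blast
  qed
  ultimately have "\<exists>c0\<in>K. \<forall>c\<in>K. n (?f c0) \<le> n (?f c)"
    by (rule continuous_attains_inf[OF _ _ n_cont])
  then obtain c0 where c0: "c0 \<in> K" "\<And>c. c \<in> K \<Longrightarrow> n (?f c0) \<le> n (?f c)" by blast
  define m where "m = n (?f c0)"
  have "m > 0"
  proof (rule ccontr)
    assume "\<not> m > 0"
    then have "?f c0 = (\<lambda>_. 0)" using norm_on_eq_0_iff[OF n, of "?f c0"] nonneg[of c0] by (simp add: m_def)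
    from indep[OF this] have "s c0 = 0" by (simp add: s_def)
    then show False using c0 by (simp add: K_def)
  qed
  have "s c \<le> 1 / m * n (?f c)" for c
  proof (cases "s c = 0")
    case True
    then show ?thesis using nonneg \<open>m > 0\<close> by simp
  next
    case False
    moreover have "s c \<ge> 0" unfolding s_def by (rule sum_nonneg) simp
    ultimately have pos: "s c > 0" by linarith
    \<comment> \<open>Normalisation of \<open>c\<close> onto the sphere, set to 0 outside
      \<open>I\<close> as membership in \<open>B\<close> requires.\<close>
    define d where "d k = (if k \<in> I then c k / s c else 0)" for k
    have "\<bar>c k\<bar> \<le> s c" if "k \<in> I" for k
      unfolding s_def by (rule member_le_sum) (use that fin in auto)
    then have "d k \<in> (if k \<in> I then {-1..1} else {0})" for k
      using pos by (simp add: d_def pos_le_divide_eq pos_divide_le_eq abs_le_iff minus_le_iff)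
    then have "d \<in> B" unfolding B_def by (simp add: PiE_iff)
    moreover have "s d = 1"
    proof -
      have "s d = (\<Sum>k\<in>I. \<bar>c k\<bar> / s c)"
        unfolding s_def[of d] using pos by (intro sum.cong) (auto simp: d_def abs_divide)
      also have "\<dots> = s c / s c" by (simp add: s_def[of c] flip: sum_divide_distrib)
      finally show ?thesis using pos by simp
    qed
    ultimately have "m \<le> n (?f d)" using c0 by (simp add: K_def m_def)
    also have "?f d = (\<lambda>p. (1 / s c) * ?f c p)"
      unfolding fin_comb_def sum_distrib_left by (intro ext sum.cong) (auto simp: d_def)
    also have "n \<dots> = \<bar>1 / s c\<bar> * n (?f c)"
      using norm_on_scale[OF n] by blast
    finally show ?thesis using pos \<open>m > 0\<close> by (simp add: field_simps)
  qed
  then show ?thesis unfolding s_def using \<open>m > 0\<close> by (intro exI[of _ "1 / m"]) auto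
qed

text \<open>Linear maps out of a finite-dimensional normed space are bounded. The identity as
  \<open>T\<close> compares two norms; the operator itself as \<open>T\<close> makes its operator
  norm finite.\<close>

lemma linear_on_set_bounded:
  assumes fin: "finite I" and R: "R = range (fin_comb I b)"
    and indep: "\<And>c. fin_comb I b c = (\<lambda>_. 0) \<Longrightarrow> \<forall>k\<in>I. c k = 0"
    and n: "norm_on R n" and n': "norm_on X n'"
    and lin: "linear_on_set R T" and T: "T ` R \<subseteq> X"
  shows "\<exists>C\<ge>0. \<forall>y\<in>R. n' (T y) \<le> C * n y"
proof -
  obtain C where C: "C \<ge> 0" "\<And>c. (\<Sum>k\<in>I. \<bar>c k\<bar>) \<le> C * n (fin_comb I b c)"
    using norm_on_coordinates_le[OF fin n[unfolded R] indep] by blast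
  define M where "M = (\<Sum>k\<in>I. n' (T (b k)))"
  have nn: "0 \<le> n' (T (b k))" if "k \<in> I" for k
    using norm_on_nonneg[OF n'] T basis_in_range[OF fin that, of b] unfolding R by blast
  have M: "n' (T (b k)) \<le> M" if "k \<in> I" for k
    unfolding M_def using member_le_sum[of k I "\<lambda>k. n' (T (b k))"] nn fin that by simp
  have "M \<ge> 0" unfolding M_def using nn by (rule sum_nonneg)
  have "n' (T (fin_comb I b c)) \<le> M * C * n (fin_comb I b c)" for c
  proof -
    have "n' (T (fin_comb I b c)) \<le> (\<Sum>k\<in>I. \<bar>c k\<bar> * n' (T (b k)))"
      using norm_on_fin_comb_le[OF fin n' lin[unfolded R] T[unfolded R]] .
    also have "\<dots> \<le> (\<Sum>k\<in>I. \<bar>c k\<bar> * M)"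
      by (intro sum_mono mult_left_mono M) auto
    also have "\<dots> = M * (\<Sum>k\<in>I. \<bar>c k\<bar>)" by (simp add: sum_distrib_left mult.commute)
    also have "\<dots> \<le> M * (C * n (fin_comb I b c))"
      by (intro mult_left_mono C \<open>M \<ge> 0\<close>)
    finally show ?thesis by (simp add: mult.assoc)
  qed
  then show ?thesis using \<open>M \<ge> 0\<close> \<open>C \<ge> 0\<close> unfolding R by (intro exI[of _ "M * C"]) auto
qed

text \<open>A real \<open>SUP\<close> is informative only for a set bounded above. Finite dimension
  supplies that bound, after which the usual rescaling to the unit ball applies.\<close>

lemma op_norm_bound:
  assumes fin: "finite I" and X: "X = range (fin_comb I b)"
    and indep: "\<And>c. fin_comb I b c = (\<lambda>_. 0) \<Longrightarrow> \<forall>k\<in>I. c k = 0"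
    and n: "norm_on X n" and lin: "linear_on_set X T" and T: "T ` X \<subseteq> X"
  shows "0 \<le> op_norm X n T" "\<And>y. y \<in> X \<Longrightarrow> n (T y) \<le> op_norm X n T * n y"
proof -
  obtain C where C: "C \<ge> 0" "\<And>y. y \<in> X \<Longrightarrow> n (T y) \<le> C * n y"
    using linear_on_set_bounded[OF fin X indep n n lin T] by blast
  have bdd: "bdd_above ((\<lambda>y. n (T y)) ` {y \<in> X. n y \<le> 1})"
    using C by (intro bdd_aboveI2[of _ _ C]) (force intro: order_trans mult_left_le)
  have le: "n (T y) \<le> op_norm X n T" if "y \<in> X" "n y \<le> 1" for y
    unfolding op_norm_def using that by (intro cSUP_upper bdd) auto
  have zero: "(\<lambda>_. 0) \<in> X" unfolding X by (rule zero_in_range)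
  have nonneg: "0 \<le> n y" if "y \<in> X" for y using norm_on_nonneg[OF n that] .
  have n0: "n (\<lambda>_. 0) = 0" using norm_on_eq_0_iff[OF n zero] by simp
  have "0 \<le> n (T (\<lambda>_. 0))" using nonneg T zero by blast
  also have "\<dots> \<le> op_norm X n T" using le zero n0 by simp
  finally show "0 \<le> op_norm X n T" .
  fix y assume y: "y \<in> X"
  show "n (T y) \<le> op_norm X n T * n y"
  proof (cases "n y = 0")
    \<comment> \<open>Rescaling is impossible here; the a priori bound with \<open>C\<close> forces
      \<open>n (T y)\<close> to vanish.\<close>
    case True
    then show ?thesis using C(2)[OF y] by simp
  next
    case False
    then have pos: "n y > 0" using nonneg[OF y] by simp
    let ?z = "\<lambda>p. (1 / n y) * y p"
    have z: "?z \<in> X" using scale_in_range y unfolding X by blast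
    have "n ?z = \<bar>1 / n y\<bar> * n y" using norm_on_scale[OF n y] .
    then have "n (T ?z) \<le> op_norm X n T" using le z pos by simp
    moreover have "T ?z = (\<lambda>p. (1 / n y) * T y p)"
    proof -
      have "T (lincomb (1 / n y) y 0 y) = lincomb (1 / n y) (T y) 0 (T y)"
        by (rule linear_on_setD[OF lin y y])
      then show ?thesis by (simp add: lincomb_def)
    qed
    moreover have "n (\<lambda>p. (1 / n y) * T y p) = \<bar>1 / n y\<bar> * n (T y)"
      using norm_on_scale[OF n] y T by blast
    ultimately have "n (T y) / n y \<le> op_norm X n T" using pos by simp
    then show ?thesis using pos by (simp add: divide_le_eq)
  qed
qed

text \<open>The contraction norm \<open>n\<close> fixes the rate \<open>op_norm X n T\<close>.
  Passing to another norm changes only the constant, so the same rate serves all norms.\<close>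

lemma picard_converges_geometrically:
  assumes fin: "finite I" and X: "X = range (fin_comb I b)"
    and indep: "\<And>c. fin_comb I b c = (\<lambda>_. 0) \<Longrightarrow> \<forall>k\<in>I. c k = 0"
    and n: "norm_on X n" and lin: "linear_on_set X T" and T: "T ` X \<subseteq> X"
    and contr: "op_norm X n T < 1"
    and y: "y \<in> X" and yr: "yr \<in> X" and sol: "(\<lambda>p. y p + T y p) = yr"
  shows "converges_geometrically X (picard T yr) y"
proof -
  let ?q = "op_norm X n T"
  let ?e = "\<lambda>l p. picard T yr l p - y p"
  have mem: "picard T yr l \<in> X" for l
  proof (induction l)
    case (Suc l)
    then have "T (picard T yr l) \<in> X" using T by blast
    then show ?case using diff_in_range yr unfolding X by simp
  qed (simp add: yr)
  have e_mem: "?e l \<in> X" for l using diff_in_range mem[of l] y unfolding X by blast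
  \<comment> \<open>Subtract \<open>yr = y + T y\<close> from the recursion. The factor -1 is kept
    as a scalar so that homogeneity of the norm removes it.\<close>
  have step: "?e (Suc l) = (\<lambda>p. (-1) * T (?e l) p)" for l
  proof -
    have "T (lincomb 1 (picard T yr l) (-1) y) = lincomb 1 (T (picard T yr l)) (-1) (T y)"
      by (rule linear_on_setD[OF lin mem y])
    then have Te: "T (?e l) = (\<lambda>p. T (picard T yr l) p - T y p)" by (simp add: lincomb_def)
    have "yr p = y p + T y p" for p using sol by auto
    then show ?thesis unfolding Te by auto
  qed
  have decay: "n (?e l) \<le> ?q ^ l * n (?e 0)" for l
  proof (induction l)
    case (Suc l)
    have "n (?e (Suc l)) = \<bar>-1\<bar> * n (T (?e l))"
      unfolding step using norm_on_scale[OF n] T e_mem by blast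
    also have "\<dots> \<le> ?q * n (?e l)" using op_norm_bound(2)[OF fin X indep n lin T e_mem] by simp
    also have "\<dots> \<le> ?q * (?q ^ l * n (?e 0))"
      using Suc op_norm_bound(1)[OF fin X indep n lin T] by (rule mult_left_mono)
    finally show ?case by simp
  qed simp
  have "\<exists>C q. 0 \<le> q \<and> q < 1 \<and> (\<forall>l. n' (?e l) \<le> C * q ^ l)" if n': "norm_on X n'" for n'
  proof -
    have id: "linear_on_set X (\<lambda>y. y)" "(\<lambda>y. y) ` X \<subseteq> X" by (auto simp: linear_on_set_def)
    obtain C where C: "C \<ge> 0" "\<And>y. y \<in> X \<Longrightarrow> n' y \<le> C * n y"
      using linear_on_set_bounded[OF fin X indep n n' id] by blast
    have "n' (?e l) \<le> C * n (?e 0) * ?q ^ l" for l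
      using order_trans[OF C(2)[OF e_mem] mult_left_mono[OF decay C(1)]]
      by (simp add: mult_ac)
    then show ?thesis using contr op_norm_bound(1)[OF fin X indep n lin T] by blast
  qed
  then show ?thesis unfolding converges_geometrically_def using mem y by blast
qed

section \<open>Linearity of the projected bias operator\<close>

lemma L2_integrable_mult:
  assumes "f \<in> L2 \<Omega>" "g \<in> L2 \<Omega>"
  shows "integrable (lebesgue_on \<Omega>) (\<lambda>p. f p * g p)"
proof (rule Bochner_Integration.integrable_bound)
  show "integrable (lebesgue_on \<Omega>) (\<lambda>p. (f p)\<^sup>2 + (g p)\<^sup>2)"
    using assms by (simp add: L2_def)
  show "(\<lambda>p. f p * g p) \<in> borel_measurable (lebesgue_on \<Omega>)"
    using assms by (auto simp: L2_def)
  have "\<bar>a * b\<bar> \<le> a\<^sup>2 + b\<^sup>2" for a b :: real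
  proof -
    have "2 * \<bar>a * b\<bar> \<le> a\<^sup>2 + b\<^sup>2"
      using sum_squares_bound[of "\<bar>a\<bar>" "\<bar>b\<bar>"] by (simp add: abs_mult)
    then show ?thesis by linarith
  qed
  then show "AE p in lebesgue_on \<Omega>. norm (f p * g p) \<le> norm ((f p)\<^sup>2 + (g p)\<^sup>2)"
    by simp
qed

text \<open>Exchanging sum and integral requires each summand to be integrable, which the L2
  hypotheses guarantee.\<close>

lemma ip_fin_comb:
  assumes "\<And>k. k \<in> I \<Longrightarrow> b k \<in> L2 \<Omega>" "g \<in> L2 \<Omega>"
  shows "ip \<Omega> (fin_comb I b c) g = (\<Sum>k\<in>I. c k * ip \<Omega> (b k) g)"
  using assms
  by (simp add: ip_def fin_comb_def sum_distrib_right mult.assoc L2_integrable_mult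
        Bochner_Integration.integral_sum)

lemma DA_subset_H1: "DA \<Omega> \<subseteq> H1 \<Omega>"
  by (auto simp: DA_def H2_def)

lemma H1_subset_L2: "H1 \<Omega> \<subseteq> L2 \<Omega>"
  by (auto simp: H1_def)

lemma wd_in_L2:
  assumes "f \<in> H1 \<Omega>" shows "wd \<Omega> i f \<in> L2 \<Omega>"
proof -
  have "\<exists>g. g \<in> L2 \<Omega> \<and> weak_partial \<Omega> i f g" using assms by (auto simp: H1_def)
  from someI_ex[OF this] show ?thesis by (simp add: wd_def)
qed

text \<open>In \<open>A0_ext\<close> the operator acts on the test function \<open>w\<close>, so
  linearity in the first argument needs no linearity of \<open>wd\<close>, which is a choice of
  representative and linear only almost everywhere. Since \<open>w\<close> is in H2, its second weak
  derivatives are in L2 and the products are integrable.\<close>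

lemma ip_A0_fin_comb:
  assumes "\<And>k. k \<in> I \<Longrightarrow> b k \<in> L2 \<Omega>" "w \<in> DA \<Omega>"
  shows "ip \<Omega> (fin_comb I b c) (A0 \<Omega> \<kappa> w) = (\<Sum>k\<in>I. c k * ip \<Omega> (b k) (A0 \<Omega> \<kappa> w))"
proof -
  have "wd \<Omega> i (wd \<Omega> i w) \<in> L2 \<Omega>" for i
    using assms(2) by (intro wd_in_L2) (simp add: DA_def H2_def)
  then have int: "integrable (lebesgue_on \<Omega>) (\<lambda>p. b k p * A0 \<Omega> \<kappa> w p)" if "k \<in> I" for k
    using L2_integrable_mult[OF assms(1)[OF that]]
    by (simp add: A0_def sum_distrib_left mult.left_commute[of _ \<kappa>])
  then show ?thesis
    by (simp add: ip_def fin_comb_def sum_distrib_right mult.assoc Bochner_Integration.integral_sum)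
qed

section \<open>Coordinates in the eigenbasis and the projection\<close>

lemma neumann_eigenbasis_L2:
  assumes "neumann_eigenbasis \<Omega> \<kappa> \<phi> \<mu>" "k \<ge> 1" shows "\<phi> k \<in> L2 \<Omega>"
  using assms DA_subset_H1 H1_subset_L2 unfolding neumann_eigenbasis_def by blast

text \<open>Orthonormality reads off coefficients. Both independence of the eigenfunctions and the
  projection identity follow from this.\<close>

lemma ip_eigenbasis:
  assumes "neumann_eigenbasis \<Omega> \<kappa> \<phi> \<mu>" "k \<in> {1..N}"
  shows "ip \<Omega> (fin_comb {1..N} \<phi> c) (\<phi> k) = c k"
proof -
  have "ip \<Omega> (fin_comb {1..N} \<phi> c) (\<phi> k) = (\<Sum>l\<in>{1..N}. c l * ip \<Omega> (\<phi> l) (\<phi> k))"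
    using assms by (intro ip_fin_comb neumann_eigenbasis_L2[of \<Omega> \<kappa> \<phi> \<mu>]) auto
  also have "\<dots> = (\<Sum>l\<in>{1..N}. if l = k then c l else 0)"
    using assms by (intro sum.cong) (auto simp: neumann_eigenbasis_def)
  finally show ?thesis using assms(2) by simp
qed

lemma eigenbasis_independent:
  assumes "neumann_eigenbasis \<Omega> \<kappa> \<phi> \<mu>" "fin_comb {1..N} \<phi> c = (\<lambda>_. 0)"
  shows "\<forall>k\<in>{1..N}. c k = 0"
proof
  fix k assume "k \<in> {1..N}"
  then have "c k = ip \<Omega> (\<lambda>_. 0) (\<phi> k)"
    using ip_eigenbasis[OF assms(1), of k N c] assms(2) by simp
  then show "c k = 0" by (simp add: ip_def)
qed

lemma PN_pivot:
  assumes "neumann_eigenbasis \<Omega> \<kappa> \<phi> \<mu>" "y \<in> XN \<phi> N"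
  shows "PN \<phi> N (pivot \<Omega> (H1 \<Omega>) y) = y"
proof -
  obtain c where c: "y = fin_comb {1..N} \<phi> c" using assms(2) by (auto simp: XN_eq_range)
  \<comment> \<open>\<open>pivot\<close> is 0 outside H1; each eigenfunction lies in
    \<open>DA\<close>, hence in H1, so its value is the true inner product.\<close>
  have "pivot \<Omega> (H1 \<Omega>) y (\<phi> k) = c k" if "k \<in> {1..N}" for k
    using ip_eigenbasis[OF assms(1) that] assms(1) that DA_subset_H1
    by (auto simp: pivot_def restr_def c neumann_eigenbasis_def)
  then have "PN \<phi> N (pivot \<Omega> (H1 \<Omega>) y) = fin_comb {1..N} \<phi> c"
    unfolding PN_def fin_comb_def by (intro ext sum.cong) auto
  then show ?thesis by (simp add: c)
qed

lemma linear_residual_forcing: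
  assumes eigen: "neumann_eigenbasis \<Omega> \<kappa> \<phi> \<mu>" and input: "steady_input \<Omega> \<kappa> \<phi> N x U"
  shows "linear_on_set (XN \<phi> N) (residual_forcing \<Omega> \<kappa> x U)"
  unfolding linear_on_set_def
proof (intro allI ballI ext)
  fix a b y z w assume y: "y \<in> XN \<phi> N" and z: "z \<in> XN \<phi> N"
  obtain c d where c: "y = fin_comb {1..N} \<phi> c" and d: "z = fin_comb {1..N} \<phi> d"
    using y z by (auto simp: XN_eq_range)
  have "A0_ext \<Omega> \<kappa> (lincomb a y b z) w = a * A0_ext \<Omega> \<kappa> y w + b * A0_ext \<Omega> \<kappa> z w"
    using ip_A0_fin_comb[of "{1..N}" \<phi> \<Omega> w _ \<kappa>] neumann_eigenbasis_L2[OF eigen]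
    by (simp add: A0_ext_def restr_def c d lincomb_fin_comb sum_distrib_left sum.distrib algebra_simps)
  moreover have "U (lincomb a y b z) = a *\<^sub>R U y + b *\<^sub>R U z"
    using input y z unfolding steady_input_def by blast
  then have "actuation \<Omega> x (U (lincomb a y b z)) w = a * actuation \<Omega> x (U y) w + b * actuation \<Omega> x (U z) w"
    by (simp add: actuation_def sum_distrib_left sum.distrib algebra_simps)
  ultimately show "residual_forcing \<Omega> \<kappa> x U (lincomb a y b z) w
      = lincomb a (residual_forcing \<Omega> \<kappa> x U y) b (residual_forcing \<Omega> \<kappa> x U z) w"
    by (simp add: residual_forcing_def lincomb_def algebra_simps)
qed

text \<open>\<open>R_cl\<close> is defined by choice, so its linearity is taken from
  \<open>R\<close>; \<open>forcing\<close> places the residuals in the space where \<open>R\<close>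
  applies. \<open>PN\<close> only evaluates functionals at the eigenfunctions and is therefore
  linear.\<close>

lemma linear_projected_bias:
  assumes eigen: "neumann_eigenbasis \<Omega> \<kappa> \<phi> \<mu>" and input: "steady_input \<Omega> \<kappa> \<phi> N x U"
    and forcing: "\<forall>y\<in>XN \<phi> N. residual_forcing \<Omega> \<kappa> x U y \<in> DA_dual \<Omega> \<kappa>"
    and R: "bounded_linear_on (DA_dual \<Omega> \<kappa>) (DA_dual_norm \<Omega> \<kappa>)
              (V_dual \<Omega> \<kappa>) (V_dual_norm \<Omega> \<kappa>) (R_cl \<Omega> \<kappa> Sx)"
  shows "linear_on_set (XN \<phi> N) (projected_bias \<Omega> \<kappa> \<phi> N x U Sx)"
  unfolding linear_on_set_def
proof (intro allI ballI)
  fix a b y z assume y: "y \<in> XN \<phi> N" and z: "z \<in> XN \<phi> N"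
  have "residual_forcing \<Omega> \<kappa> x U (lincomb a y b z)
      = lincomb a (residual_forcing \<Omega> \<kappa> x U y) b (residual_forcing \<Omega> \<kappa> x U z)"
    by (rule linear_on_setD[OF linear_residual_forcing[OF eigen input] y z])
  then have "bias_map \<Omega> \<kappa> x U Sx (lincomb a y b z)
      = lincomb a (bias_map \<Omega> \<kappa> x U Sx y) b (bias_map \<Omega> \<kappa> x U Sx z)"
    using R forcing y z unfolding bias_map_def bounded_linear_on_def by simp
  then show "projected_bias \<Omega> \<kappa> \<phi> N x U Sx (lincomb a y b z)
      = lincomb a (projected_bias \<Omega> \<kappa> \<phi> N x U Sx y) b (projected_bias \<Omega> \<kappa> \<phi> N x U Sx z)"
    by (simp add: projected_bias_def PN_def lincomb_def sum_distrib_left sum.distrib algebra_simps)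
qed

section \<open>Solvability, projected limit and Picard iteration\<close>

theorem proposition5p8:
  fixes \<Omega> :: "(real^3) set" and \<kappa> gain :: real
    and \<phi> :: "nat \<Rightarrow> real^3 \<Rightarrow> real" and \<mu> :: "nat \<Rightarrow> real" and N :: nat
    and x :: "'m::finite \<Rightarrow> real^3" and U :: "(real^3 \<Rightarrow> real) \<Rightarrow> real^'m"
    and S Sx :: "real \<Rightarrow> ((real^3 \<Rightarrow> real) \<Rightarrow> real) \<Rightarrow> (real^3 \<Rightarrow> real) \<Rightarrow> real"
    and yr :: "real^3 \<Rightarrow> real"
    and T :: "(real^3 \<Rightarrow> real) \<Rightarrow> real^3 \<Rightarrow> real" and X :: "(real^3 \<Rightarrow> real) set"
  assumes X_def: "X = XN \<phi> N" and T_def: "T = projected_bias \<Omega> \<kappa> \<phi> N x U Sx"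
    and domain: "bounded_C2_domain \<Omega>" and kappa: "\<kappa> > 0"
    and eigen: "neumann_eigenbasis \<Omega> \<kappa> \<phi> \<mu>"
    and points: "\<forall>j. x j \<in> \<Omega>"
    and full_row_rank: "dim ((\<lambda>k. \<chi> j. pt_eval \<Omega> (\<phi> k) (x j)) ` {1..N}) = N"
    and input: "steady_input \<Omega> \<kappa> \<phi> N x U"
    and forcing: "\<forall>y\<in>X. residual_forcing \<Omega> \<kappa> x U y \<in> DA_dual \<Omega> \<kappa>"
    and gain: "gain > 0"
    and semigroup: "closed_loop_semigroup \<Omega> \<kappa> x gain S"
    and stable: "exp_stable (V_dual \<Omega> \<kappa>) (V_dual_norm \<Omega> \<kappa>) S"
    and extension: "semigroup_extension \<Omega> \<kappa> S Sx"
    and integral_exists: "\<forall>h\<in>DA_dual \<Omega> \<kappa>. \<exists>r. is_orbit_integral \<Omega> \<kappa> Sx h r"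
    and R_bounded: "bounded_linear_on (DA_dual \<Omega> \<kappa>) (DA_dual_norm \<Omega> \<kappa>)
                      (V_dual \<Omega> \<kappa>) (V_dual_norm \<Omega> \<kappa>) (R_cl \<Omega> \<kappa> Sx)"
    and yr: "yr \<in> X"
  shows "(bij_betw (\<lambda>y p. y p + T y p) X X \<longrightarrow>
            (\<exists>!y. y \<in> X \<and> (\<lambda>p. y p + T y p) = yr) \<and>
            (\<forall>y\<in>X. (\<lambda>p. y p + T y p) = yr \<longrightarrow> PN \<phi> N (y_inf \<Omega> \<kappa> x U Sx y) = yr)) \<and>
         (bij_betw (\<lambda>y p. y p + T y p) X X \<and> (\<exists>n. norm_on X n \<and> op_norm X n T < 1) \<longrightarrow>
            (\<exists>!y. y \<in> X \<and> (\<lambda>p. y p + T y p) = yr) \<and>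
            (\<forall>y\<in>X. (\<lambda>p. y p + T y p) = yr \<longrightarrow> converges_geometrically X (picard T yr) y))"
proof -
  have X: "X = range (fin_comb {1..N} \<phi>)" by (simp add: X_def XN_eq_range)
  have lin: "linear_on_set X T"
    unfolding X_def T_def
    using linear_projected_bias[OF eigen input forcing[unfolded X_def] R_bounded] .
  have T: "T ` X \<subseteq> X"
    by (auto simp: T_def X_def projected_bias_def PN_def XN_def)
  have ex1: "\<exists>!y. y \<in> X \<and> (\<lambda>p. y p + T y p) = yr"
    if "bij_betw (\<lambda>y p. y p + T y p) X X"
  proof -
    have inj: "inj_on (\<lambda>y p. y p + T y p) X" and "yr \<in> (\<lambda>y p. y p + T y p) ` X"
      using that yr by (auto simp: bij_betw_def)
    then obtain y where y: "y \<in> X" "(\<lambda>p. y p + T y p) = yr" by blast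
    show ?thesis
    proof (rule ex1I[of _ y])
      fix z assume "z \<in> X \<and> (\<lambda>p. z p + T z p) = yr"
      then show "z = y" using inj_onD[OF inj, of z y] y by simp
    qed (use y in simp)
  qed
  have proj: "PN \<phi> N (y_inf \<Omega> \<kappa> x U Sx y) = yr" if "y \<in> X" "(\<lambda>p. y p + T y p) = yr" for y
  proof -
    \<comment> \<open>Additivity of \<open>PN\<close> turns the projected limit into
      \<open>y + T y\<close>, the left side of the equation, once \<open>PN\<close> is known to fix
      \<open>y\<close>.\<close>
    have "PN \<phi> N (y_inf \<Omega> \<kappa> x U Sx y) = (\<lambda>p. PN \<phi> N (pivot \<Omega> (H1 \<Omega>) y) p + T y p)"
      by (simp add: PN_def y_inf_def T_def projected_bias_def sum.distrib algebra_simps)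
    then show ?thesis using PN_pivot[OF eigen] that by (simp add: X_def)
  qed
  have picard: "converges_geometrically X (picard T yr) y"
    if "norm_on X n" "op_norm X n T < 1" "y \<in> X" "(\<lambda>p. y p + T y p) = yr" for n y
    by (rule picard_converges_geometrically[OF finite_atLeastAtMost X
          eigenbasis_independent[OF eigen] that(1) lin T that(2,3) yr that(4)])
  show ?thesis
  proof (intro conjI impI ballI)
    fix y
    assume "bij_betw (\<lambda>y p. y p + T y p) X X \<and> (\<exists>n. norm_on X n \<and> op_norm X n T < 1)"
      and y: "y \<in> X" "(\<lambda>p. y p + T y p) = yr"
    then obtain n where "norm_on X n" "op_norm X n T < 1" by (elim conjE exE)
    then show "converges_geometrically X (picard T yr) y" using y by (rule picard)
  qed (erule (1) proj | rule ex1, (erule conjunct1 | assumption))+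
qed

end
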